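(* Consider the perturbed Super-Kagome lattice with fixed vertex weight $\mu>0$ and periodic edge weights $\gamma_1,\dots,\gamma_9>0$ satisfying the constant vertex weight condition $$\gamma_2+\gamma_3+\gamma_7=\gamma_5+\gamma_6+\gamma_7=\gamma_1+\gamma_2+\gamma_8=\gamma_4+\gamma_5+\gamma_8=\gamma_1+\gamma_3+\gamma_9=\gamma_4+\gamma_6+\gamma_9=\mu,$$ and with Laplacian $(\Delta_\gamma f)(v)=f(v)-\frac1\mu\sum_{w\sim v}\gamma_{vw}f(w)$ on $\ell^2(V)$. Then the following are equivalent: (i) There exist exactly two flat bands of $\Delta_\gamma$. (ii) The Super-Kagome lattice is monomeric. More explicitly, there are $\alpha,\beta>0$ with $2\alpha+\beta=\mu$ such that $\gamma_1=\gamma_2=\gamma_3=\gamma_4=\gamma_5=\gamma_6=\alpha$ and $\gamma_7=\gamma_8=\gamma_9=\beta$.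
   Context: The Super-Kagome lattice is the Archimedean tiling $(3.12^2)$, in which every vertex is surrounded by one triangle and two dodecagons. As a graph with periodic edge weights it is described as follows. The vertex set is $V=\{v_j+\beta : j\in\{1,\dots,6\},\ \beta\in\mathbb{Z}^2\}$ (disjoint translates of six vertices), with translations $T_{\beta'}(v_j+\beta)=v_j+\beta+\beta'$; write $\omega_1=(1,0)$, $\omega_2=(0,1)$. The edges are the $\mathbb{Z}^2$-translates of the following nine edges, with the weights indicated (symmetric and constant along translates): $v_5\sim v_6$ ($\gamma_1$), $v_4\sim v_6$ ($\gamma_2$), $v_4\sim v_5$ ($\gamma_3$), $v_1\sim v_2$ ($\gamma_4$), $v_2\sim v_3$ ($\gamma_5$), $v_1\sim v_3$ ($\gamma_6$), $v_3\sim v_4$ ($\gamma_7$), $v_2\sim v_6+\omega_1$ ($\gamma_8$), $v_1\sim v_5+\omega_2$ ($\gamma_9$). Weights $\gamma_1,\dots,\gamma_6$ are on edges of triangles; $\gamma_7,\gamma_8,\gamma_9$ are on edges separating two dodecagons. The condition in the claim says that $\sum_{w\sim v}\gamma_{vw}=\mu$ for every $v\in V$. The lattice with its weights is monomeric if for all $v\in V$ the list of edge weights, arranged cyclically around $v$ in the planar tiling, coincides up to cyclic permutations. Flat bands: for $\theta\in\mathbb{R}^2$ let $\ell^2(V)_\theta=\{f:V\to\mathbb{C}: f(T_\beta v)=e^{i\langle\theta,\beta\rangle}f(v)\ \text{for all } v,\beta\}$ (6-dimensional) and let $\Delta_\gamma^\theta$ be the operator on $\ell^2(V)_\theta$ given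 by the same formula as $\Delta_\gamma$. With $w=e^{i\theta_1}$, $z=e^{i\theta_2}$ it is represented by $$\Delta_\gamma^\theta=\mathrm{Id}-\frac1\mu\begin{pmatrix}0&\gamma_4&\gamma_6&0&z\gamma_9&0\\ \gamma_4&0&\gamma_5&0&0&w\gamma_8\\ \gamma_6&\gamma_5&0&\gamma_7&0&0\\ 0&0&\gamma_7&0&\gamma_3&\gamma_2\\ \overline z\gamma_9&0&0&\gamma_3&0&\gamma_1\\ 0&\overline w\gamma_8&0&\gamma_2&\gamma_1&0\end{pmatrix}.$$ $\Delta_\gamma$ has a flat band at energy $E\in\mathbb{R}$ if $E\in\sigma(\Delta_\gamma^\theta)$ for all $\theta$ (equivalently, there is an infinite orthonormal family of eigenfunctions of $\Delta_\gamma$ in $\ell^2(V)$ to the eigenvalue $E$). The number of flat bands is the number of such energies $E$.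
   Formalization: Condition (ii) is taken as "monomeric and of the explicit form with α, β": monomeric alone does not imply the explicit form or two flat bands, e.g. γ1=γ4=γ7=1, γ2=γ5=γ9=2, γ3=γ6=γ8=3, μ=6. *)

theory Defs
  imports Complex_Main "HOL-Library.Product_Plus"
begin

datatype site = V1 | V2 | V3 | V4 | V5 | V6

type_synonym vertex = "site \<times> (int \<times> int)"

definition translate :: "int \<times> int \<Rightarrow> vertex \<Rightarrow> vertex" where
  "translate \<beta> v = (fst v, snd v + \<beta>)"

text \<open>The index \<open>k\<close> of \<open>bond k u v\<close> is the index of the weight carried by the edge.\<close>

inductive bond :: "nat \<Rightarrow> vertex \<Rightarrow> vertex \<Rightarrow> bool" where
  "bond 1 (V5, n) (V6, n)"
| "bond 2 (V4, n) (V6, n)"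
| "bond 3 (V4, n) (V5, n)"
| "bond 4 (V1, n) (V2, n)"
| "bond 5 (V2, n) (V3, n)"
| "bond 6 (V1, n) (V3, n)"
| "bond 7 (V3, n) (V4, n)"
| "bond 8 (V2, n) (V6, n + (1, 0))"
| "bond 9 (V1, n) (V5, n + (0, 1))"

definition joins :: "nat \<Rightarrow> vertex \<Rightarrow> vertex \<Rightarrow> bool" where
  "joins k u v \<longleftrightarrow> bond k u v \<or> bond k v u"

definition neighbours :: "vertex \<Rightarrow> vertex set" where
  "neighbours v = {w. \<exists>k. joins k v w}"

text \<open>Adjacent vertices are joined by exactly one edge; the value is used only for those.\<close>

definition edge_weight :: "(nat \<Rightarrow> real) \<Rightarrow> vertex \<Rightarrow> vertex \<Rightarrow> real" where
  "edge_weight \<gamma> v w = \<gamma> (THE k. joins k v w)"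

definition laplacian ::
  "(nat \<Rightarrow> real) \<Rightarrow> real \<Rightarrow> (vertex \<Rightarrow> complex) \<Rightarrow> vertex \<Rightarrow> complex" where
  "laplacian \<gamma> \<mu> f v =
     f v - 1 / of_real \<mu> * (\<Sum>w\<in>neighbours v. of_real (edge_weight \<gamma> v w) * f w)"

definition quasi_periodic :: "real \<times> real \<Rightarrow> (vertex \<Rightarrow> complex) set" where
  "quasi_periodic \<theta> =
     {f. \<forall>v \<beta>. f (translate \<beta> v)
            = exp (\<i> * of_real (fst \<theta> * of_int (fst \<beta>) + snd \<theta> * of_int (snd \<beta>))) * f v}"

text \<open>
  The space \<open>quasi_periodic \<theta>\<close> is 6-dimensional and invariant under the Laplacian,
  so the spectrum of the restricted operator is its set of eigenvalues.
\<close>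

definition fibre_spectrum :: "(nat \<Rightarrow> real) \<Rightarrow> real \<Rightarrow> real \<times> real \<Rightarrow> complex set" where
  "fibre_spectrum \<gamma> \<mu> \<theta> =
     {z. \<exists>f \<in> quasi_periodic \<theta>. f \<noteq> (\<lambda>v. 0) \<and> (\<forall>v. laplacian \<gamma> \<mu> f v = z * f v)}"

definition flat_bands :: "(nat \<Rightarrow> real) \<Rightarrow> real \<Rightarrow> real set" where
  "flat_bands \<gamma> \<mu> = {E. \<forall>\<theta>. complex_of_real E \<in> fibre_spectrum \<gamma> \<mu> \<theta>}"

text \<open>
  Neighbours in counterclockwise order.  Draw \<open>(1, 0)\<close> and \<open>(0, 1)\<close> as vectors of equal length
  at directions \<open>0\<close> and \<open>60\<close> degrees.  The edges leaving the triangle \<open>V1 V2 V3\<close>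
  at \<open>V3\<close>, \<open>V2\<close>, \<open>V1\<close> then point in the directions \<open>210\<close>, \<open>330\<close>, \<open>90\<close> degrees, so that
  \<open>V3, V2, V1\<close> is a counterclockwise triangle; rotation by \<open>180\<close> degrees about the midpoint
  of the edge \<open>V3 V4\<close> shows that \<open>V4, V6, V5\<close> is one too.  Each list starts with the edge
  between two dodecagons.  Drawing the tiling mirrored reverses all lists simultaneously, which
  does not affect \<open>monomeric\<close> below.
\<close>

fun ccw_neighbours :: "vertex \<Rightarrow> vertex list" where
  "ccw_neighbours (V1, n) = [(V5, n + (0, 1)), (V3, n), (V2, n)]"
| "ccw_neighbours (V2, n) = [(V6, n + (1, 0)), (V1, n), (V3, n)]"
| "ccw_neighbours (V3, n) = [(V4, n), (V2, n), (V1, n)]"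
| "ccw_neighbours (V4, n) = [(V3, n), (V6, n), (V5, n)]"
| "ccw_neighbours (V5, n) = [(V1, n - (0, 1)), (V4, n), (V6, n)]"
| "ccw_neighbours (V6, n) = [(V2, n - (1, 0)), (V5, n), (V4, n)]"

definition weight_cycle :: "(nat \<Rightarrow> real) \<Rightarrow> vertex \<Rightarrow> real list" where
  "weight_cycle \<gamma> v = map (edge_weight \<gamma> v) (ccw_neighbours v)"

definition monomeric :: "(nat \<Rightarrow> real) \<Rightarrow> bool" where
  "monomeric \<gamma> \<longleftrightarrow> (\<forall>u v. \<exists>k. weight_cycle \<gamma> v = rotate k (weight_cycle \<gamma> u))"

lemma joins_iff:
  "joins k (s, n) (t, m) \<longleftrightarrow>
     k = 1 \<and> (s = V5 \<and> t = V6 \<or> s = V6 \<and> t = V5) \<and> m = n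
   \<or> k = 2 \<and> (s = V4 \<and> t = V6 \<or> s = V6 \<and> t = V4) \<and> m = n
   \<or> k = 3 \<and> (s = V4 \<and> t = V5 \<or> s = V5 \<and> t = V4) \<and> m = n
   \<or> k = 4 \<and> (s = V1 \<and> t = V2 \<or> s = V2 \<and> t = V1) \<and> m = n
   \<or> k = 5 \<and> (s = V2 \<and> t = V3 \<or> s = V3 \<and> t = V2) \<and> m = n
   \<or> k = 6 \<and> (s = V1 \<and> t = V3 \<or> s = V3 \<and> t = V1) \<and> m = n
   \<or> k = 7 \<and> (s = V3 \<and> t = V4 \<or> s = V4 \<and> t = V3) \<and> m = n
   \<or> k = 8 \<and> (s = V2 \<and> t = V6 \<and> m = n + (1, 0) \<or> s = V6 \<and> t = V2 \<and> m = n - (1, 0))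
   \<or> k = 9 \<and> (s = V1 \<and> t = V5 \<and> m = n + (0, 1) \<or> s = V5 \<and> t = V1 \<and> m = n - (0, 1))"
  unfolding joins_def bond.simps by (cases s; cases t; cases n; cases m; auto)

lemma neighbours_eq_ccw: "neighbours v = set (ccw_neighbours v)"
proof -
  obtain s n where v: "v = (s, n)" by (rule prod.exhaust)
  show ?thesis unfolding v neighbours_def by (cases s) (auto simp: joins_iff)
qed

lemma weight_cycle_simps:
  "weight_cycle \<gamma> (V1, n) = [\<gamma> 9, \<gamma> 6, \<gamma> 4]"
  "weight_cycle \<gamma> (V2, n) = [\<gamma> 8, \<gamma> 4, \<gamma> 5]"
  "weight_cycle \<gamma> (V3, n) = [\<gamma> 7, \<gamma> 5, \<gamma> 6]"
  "weight_cycle \<gamma> (V4, n) = [\<gamma> 7, \<gamma> 2, \<gamma> 3]"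
  "weight_cycle \<gamma> (V5, n) = [\<gamma> 9, \<gamma> 3, \<gamma> 1]"
  "weight_cycle \<gamma> (V6, n) = [\<gamma> 8, \<gamma> 1, \<gamma> 2]"
  by (simp_all add: weight_cycle_def edge_weight_def joins_iff)

text \<open>
  Being monomeric alone does not force all triangle edges to have equal weight: the property also
  holds when the three edge directions of every triangle carry arbitrary weights \<open>a\<close>, \<open>b\<close>, \<open>c\<close>
  and each edge between dodecagons carries the weight of the opposite triangle edges; every
  vertex then has weight \<open>a + b + c\<close>.
\<close>

lemma monomeric_three_weights:
  assumes "\<gamma> 1 = a" "\<gamma> 4 = a" "\<gamma> 7 = a"
    and "\<gamma> 2 = b" "\<gamma> 5 = b" "\<gamma> 9 = b"
    and "\<gamma> 3 = c" "\<gamma> 6 = c" "\<gamma> 8 = c"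
  shows "monomeric \<gamma>"
proof -
  have *: "\<exists>i<3. weight_cycle \<gamma> v = rotate i [a, b, c]" for v
  proof -
    obtain s n where v: "v = (s, n)" by (rule prod.exhaust)
    have "weight_cycle \<gamma> v = rotate 0 [a, b, c] \<or> weight_cycle \<gamma> v = rotate 1 [a, b, c]
        \<or> weight_cycle \<gamma> v = rotate 2 [a, b, c]"
      unfolding v
      by (cases s) (simp_all add: weight_cycle_simps assms assms(1)[simplified] rotate_drop_take)
    then show ?thesis by (elim disjE) (auto intro: exI[of _ 0] exI[of _ 1] exI[of _ 2])
  qed
  show ?thesis unfolding monomeric_def
  proof (intro allI)
    fix u v
    obtain i j where i: "i < 3" "weight_cycle \<gamma> u = rotate i [a, b, c]"
      and j: "weight_cycle \<gamma> v = rotate j [a, b, c]" using * by metis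
    have "rotate (j + (3 - i)) (weight_cycle \<gamma> u) = rotate (j + 3) [a, b, c]"
      using i by (simp add: rotate_rotate)
    also have "\<dots> = weight_cycle \<gamma> v"
      using rotate_id[of 3 "[a, b, c]"] by (simp add: j rotate_rotate[symmetric])
    finally show "\<exists>k. weight_cycle \<gamma> v = rotate k (weight_cycle \<gamma> u)" by metis
  qed
qed

end

theory Submission
  imports Defs
begin

text \<open>
  The vertex conditions force \<open>\<gamma> 4 = \<gamma> 1\<close>, \<open>\<gamma> 5 = \<gamma> 2\<close>, \<open>\<gamma> 6 = \<gamma> 3\<close>.  Pairing the sites
  \<open>V1, V2, V3\<close> with \<open>V5, V6, V4\<close>, the fibre matrix therefore consists of two equal diagonal blocks
  \<open>A\<close> and off-diagonal blocks \<open>D\<close>, \<open>D\<^sup>*\<close>, where \<open>D = diag (z \<gamma>\<^sub>9, w \<gamma>\<^sub>8, \<gamma>\<^sub>7)\<close>.  Its characteristic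
  polynomial is a combination of \<open>1\<close>, \<open>Re z\<close>, \<open>Re w\<close> and \<open>Re (z \<sqdot> cnj w)\<close>.  At a flat band all
  coefficients vanish, and they can be read off from the four real fibres \<open>z, w \<in> {1, -1}\<close>, where
  the determinant factors as \<open>det (A - \<lambda> + D) \<sqdot> det (A - \<lambda> - D)\<close>.  This yields three quadratic
  equations for \<open>\<lambda>\<close>.  If two different \<open>\<lambda>\<close> solve all three, then comparing the sums of the roots
  gives \<open>\<gamma>\<^sub>1 = \<gamma>\<^sub>2 = \<gamma>\<^sub>3\<close>.  Conversely, for equal weights \<open>\<alpha>\<close> and \<open>\<beta>\<close> the quadratics leave only
  \<open>\<lambda> = -\<alpha> \<plusminus> \<beta>\<close>, and vectors \<open>(x, \<plusminus> U\<^sup>* x)\<close>, with \<open>U = D / \<beta>\<close> and both halves having sum zero,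
  are eigenvectors.
\<close>

section \<open>Reduction to six linear equations per fibre\<close>

lemma laplacian_simps:
  "laplacian \<gamma> \<mu> f (V1, n) =
     f (V1, n) - (\<gamma> 4 * f (V2, n) + \<gamma> 6 * f (V3, n) + \<gamma> 9 * f (V5, n + (0, 1))) / \<mu>"
  "laplacian \<gamma> \<mu> f (V2, n) =
     f (V2, n) - (\<gamma> 4 * f (V1, n) + \<gamma> 5 * f (V3, n) + \<gamma> 8 * f (V6, n + (1, 0))) / \<mu>"
  "laplacian \<gamma> \<mu> f (V3, n) =
     f (V3, n) - (\<gamma> 6 * f (V1, n) + \<gamma> 5 * f (V2, n) + \<gamma> 7 * f (V4, n)) / \<mu>"
  "laplacian \<gamma> \<mu> f (V4, n) =
     f (V4, n) - (\<gamma> 7 * f (V3, n) + \<gamma> 3 * f (V5, n) + \<gamma> 2 * f (V6, n)) / \<mu>"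
  "laplacian \<gamma> \<mu> f (V5, n) =
     f (V5, n) - (\<gamma> 9 * f (V1, n - (0, 1)) + \<gamma> 3 * f (V4, n) + \<gamma> 1 * f (V6, n)) / \<mu>"
  "laplacian \<gamma> \<mu> f (V6, n) =
     f (V6, n) - (\<gamma> 8 * f (V2, n - (1, 0)) + \<gamma> 2 * f (V4, n) + \<gamma> 1 * f (V5, n)) / \<mu>"
  by (simp_all add: laplacian_def neighbours_eq_ccw edge_weight_def joins_iff
      add_divide_distrib algebra_simps)

text \<open>The eigenvalue \<open>l\<close> is that of the weighted adjacency matrix and corresponds
  to the energy \<open>1 - l / \<mu>\<close>; \<open>w\<close> and \<open>z\<close> are the phases
  of the translations by \<open>(1, 0)\<close> and \<open>(0, 1)\<close>.\<close>

definition fibre_eigenvector ::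
  "(nat \<Rightarrow> real) \<Rightarrow> complex \<Rightarrow> complex \<Rightarrow> complex \<Rightarrow> (site \<Rightarrow> complex) \<Rightarrow> bool" where
  "fibre_eigenvector \<gamma> w z l x \<longleftrightarrow>
     l * x V1 = \<gamma> 4 * x V2 + \<gamma> 6 * x V3 + \<gamma> 9 * (z * x V5) \<and>
     l * x V2 = \<gamma> 4 * x V1 + \<gamma> 5 * x V3 + \<gamma> 8 * (w * x V6) \<and>
     l * x V3 = \<gamma> 6 * x V1 + \<gamma> 5 * x V2 + \<gamma> 7 * x V4 \<and>
     l * x V4 = \<gamma> 7 * x V3 + \<gamma> 3 * x V5 + \<gamma> 2 * x V6 \<and>
     l * x V5 = \<gamma> 9 * (cnj z * x V1) + \<gamma> 3 * x V4 + \<gamma> 1 * x V6 \<and>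
     l * x V6 = \<gamma> 8 * (cnj w * x V2) + \<gamma> 2 * x V4 + \<gamma> 1 * x V5 \<and>
     (\<exists>s. x s \<noteq> 0)"

lemma quasi_periodic_iff:
  "f \<in> quasi_periodic \<theta> \<longleftrightarrow>
     (\<forall>s n. f (s, n) = cis (fst \<theta> * of_int (fst n) + snd \<theta> * of_int (snd n)) * f (s, 0))"
  (is "_ \<longleftrightarrow> (\<forall>s n. f (s, n) = ?e n * f (s, 0))")
proof
  assume "f \<in> quasi_periodic \<theta>"
  then have qp: "f (translate n (s, 0)) = ?e n * f (s, 0)" for s n
    unfolding quasi_periodic_def cis_conv_exp by blast
  show "\<forall>s n. f (s, n) = ?e n * f (s, 0)"
  proof (intro allI)
    show "f (s, n) = ?e n * f (s, 0)" for s n using qp[of n s] by (simp add: translate_def)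
  qed
next
  assume f: "\<forall>s n. f (s, n) = ?e n * f (s, 0)"
  have e: "?e (n + m) = ?e m * ?e n" for n m
    unfolding cis_mult by (rule arg_cong[of _ _ cis]) (simp add: algebra_simps)
  have "f (translate m v) = ?e m * f v" for v m
  proof -
    obtain s n where v: "v = (s, n)" by (rule prod.exhaust)
    have "f (s, n + m) = ?e (n + m) * f (s, 0)" by (rule f[rule_format])
    also have "\<dots> = ?e m * (?e n * f (s, 0))" by (simp only: e mult.assoc)
    also have "\<dots> = ?e m * f (s, n)" by (simp only: f[rule_format, of s n])
    finally show ?thesis by (simp add: v translate_def)
  qed
  then show "f \<in> quasi_periodic \<theta>" by (simp add: quasi_periodic_def cis_conv_exp)
qed

lemma laplacian_eigen_iff:
  fixes \<mu> :: real and u s l :: complex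
  assumes "\<mu> \<noteq> 0"
  shows "u - s / \<mu> = (1 - l / \<mu>) * u \<longleftrightarrow> l * u = s"
  using assms by (auto simp: field_simps)

text \<open>A quasi-periodic function is determined by its six values on the cell \<open>0\<close>.
  Conversely, extending six values by phases turns the equations at cell \<open>n\<close> into those
  at cell \<open>0\<close>, multiplied by one common phase.\<close>

lemma fibre_spectrum_iff:
  assumes "\<mu> \<noteq> 0"
  shows "1 - l / of_real \<mu> \<in> fibre_spectrum \<gamma> \<mu> \<theta> \<longleftrightarrow>
    (\<exists>x. fibre_eigenvector \<gamma> (cis (fst \<theta>)) (cis (snd \<theta>)) l x)"
proof
  assume "1 - l / of_real \<mu> \<in> fibre_spectrum \<gamma> \<mu> \<theta>"
  then obtain f where f: "f \<in> quasi_periodic \<theta>" "f \<noteq> (\<lambda>v. 0)"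
    and eig: "\<And>v. laplacian \<gamma> \<mu> f v = (1 - l / \<mu>) * f v"
    unfolding fibre_spectrum_def by blast
  have qp: "f (s, n) = cis (fst \<theta> * of_int (fst n) + snd \<theta> * of_int (snd n)) * f (s, 0)" for s n
    using f(1) unfolding quasi_periodic_iff by blast
  have "\<exists>s. f (s, 0) \<noteq> 0"
  proof (rule ccontr)
    assume "\<not> ?thesis"
    then have "f v = 0" for v using qp[of "fst v" "snd v"] by simp
    then show False using f(2) by blast
  qed
  \<comment> \<open>These are the only neighbours of the cell \<open>0\<close> outside it.\<close>
  moreover have shift:
      "f (V5, (0, 1)) = cis (snd \<theta>) * f (V5, 0)" "f (V6, (1, 0)) = cis (fst \<theta>) * f (V6, 0)"
      "f (V1, - (0, 1)) = cnj (cis (snd \<theta>)) * f (V1, 0)"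
      "f (V2, - (1, 0)) = cnj (cis (fst \<theta>)) * f (V2, 0)"
    using qp[of V5 "(0, 1)"] qp[of V6 "(1, 0)"] qp[of V1 "- (0, 1)"] qp[of V2 "- (1, 0)"]
    by (simp_all add: cis_cnj)
  ultimately have "fibre_eigenvector \<gamma> (cis (fst \<theta>)) (cis (snd \<theta>)) l (\<lambda>s. f (s, 0))"
    using eig[of "(V1, 0)"] eig[of "(V2, 0)"] eig[of "(V3, 0)"]
      eig[of "(V4, 0)"] eig[of "(V5, 0)"] eig[of "(V6, 0)"]
    unfolding fibre_eigenvector_def laplacian_simps laplacian_eigen_iff[OF assms]
      add_0 diff_0 shift
    by (simp only: simp_thms algebra_simps)
  then show "\<exists>x. fibre_eigenvector \<gamma> (cis (fst \<theta>)) (cis (snd \<theta>)) l x" by blast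
next
  assume "\<exists>x. fibre_eigenvector \<gamma> (cis (fst \<theta>)) (cis (snd \<theta>)) l x"
  then obtain x where x: "fibre_eigenvector \<gamma> (cis (fst \<theta>)) (cis (snd \<theta>)) l x" ..
  define e where "e n = cis (fst \<theta> * of_int (fst n) + snd \<theta> * of_int (snd n))" for n :: "int \<times> int"
  define f where "f v = e (snd v) * x (fst v)" for v
  have e: "e (n + (0, 1)) = cis (snd \<theta>) * e n" "e (n + (1, 0)) = cis (fst \<theta>) * e n"
    "e (n - (0, 1)) = cnj (cis (snd \<theta>)) * e n" "e (n - (1, 0)) = cnj (cis (fst \<theta>)) * e n" for n
    by (simp_all add: e_def cis_cnj cis_mult algebra_simps)
  have "f \<in> quasi_periodic \<theta>" by (simp add: quasi_periodic_iff f_def e_def)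
  moreover have "f \<noteq> (\<lambda>v. 0)"
  proof
    assume "f = (\<lambda>v. 0)"
    then have "f (s, 0) = 0" for s by simp
    then show False using x by (simp add: f_def e_def fibre_eigenvector_def)
  qed
  moreover have "laplacian \<gamma> \<mu> f v = (1 - l / \<mu>) * f v" for v
  proof -
    obtain s n where v: "v = (s, n)" by (rule prod.exhaust)
    have shift: "u - t / \<mu> = (1 - l / \<mu>) * u" if "l * y = t'" "u = e n * y" "t = e n * t'"
      for u y t t'
      unfolding laplacian_eigen_iff[OF assms] using that by (simp add: mult.left_commute)
    note eqs1 = x[unfolded fibre_eigenvector_def]
    note eqs2 = eqs1[THEN conjunct2]
    note eqs3 = eqs2[THEN conjunct2]
    note eqs4 = eqs3[THEN conjunct2]
    note eqs5 = eqs4[THEN conjunct2]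
    note eqs6 = eqs5[THEN conjunct2]
    show ?thesis
    proof (cases s)
      case V1
      show ?thesis unfolding v V1 laplacian_simps
        by (rule shift[OF eqs1[THEN conjunct1]])
          (simp_all only: f_def fst_conv snd_conv e distrib_left mult_ac)
    next
      case V2
      show ?thesis unfolding v V2 laplacian_simps
        by (rule shift[OF eqs2[THEN conjunct1]])
          (simp_all only: f_def fst_conv snd_conv e distrib_left mult_ac)
    next
      case V3
      show ?thesis unfolding v V3 laplacian_simps
        by (rule shift[OF eqs3[THEN conjunct1]])
          (simp_all only: f_def fst_conv snd_conv e distrib_left mult_ac)
    next
      case V4
      show ?thesis unfolding v V4 laplacian_simps
        by (rule shift[OF eqs4[THEN conjunct1]])
          (simp_all only: f_def fst_conv snd_conv e distrib_left mult_ac)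
    next
      case V5
      show ?thesis unfolding v V5 laplacian_simps
        by (rule shift[OF eqs5[THEN conjunct1]])
          (simp_all only: f_def fst_conv snd_conv e distrib_left mult_ac)
    next
      case V6
      show ?thesis unfolding v V6 laplacian_simps
        by (rule shift[OF eqs6[THEN conjunct1]])
          (simp_all only: f_def fst_conv snd_conv e distrib_left mult_ac)
    qed
  qed
  ultimately show "1 - l / of_real \<mu> \<in> fibre_spectrum \<gamma> \<mu> \<theta>"
    unfolding fibre_spectrum_def by blast
qed

lemma flat_band_iff:
  assumes "\<mu> \<noteq> 0"
  shows "1 - l / \<mu> \<in> flat_bands \<gamma> \<mu> \<longleftrightarrow>
    (\<forall>\<theta>. \<exists>x. fibre_eigenvector \<gamma> (cis (fst \<theta>)) (cis (snd \<theta>)) (complex_of_real l) x)"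
  using fibre_spectrum_iff[OF assms, of "complex_of_real l"] by (simp add: flat_bands_def)

section \<open>Determinants at real fibres\<close>

text \<open>Determinant of the symmetric matrix with rows \<open>(P, a, c)\<close>,
  \<open>(a, Q, b)\<close>, \<open>(c, b, R)\<close>.\<close>

definition sym_det :: "'a::comm_ring_1 \<Rightarrow> 'a \<Rightarrow> 'a \<Rightarrow> 'a \<Rightarrow> 'a \<Rightarrow> 'a \<Rightarrow> 'a" where
  "sym_det a b c P Q R = P * Q * R + 2 * a * b * c - P * b^2 - Q * c^2 - R * a^2"

lemma of_real_sym_det:
  "of_real (sym_det a b c P Q R) =
    sym_det (of_real a) (of_real b) (of_real c) (of_real P) (of_real Q) (of_real R)"
  by (simp add: sym_det_def)

text \<open>Cramer's rule: multiplying the equations by cofactors shows that the determinant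
  annihilates each unknown.\<close>

lemma sym_det_zero:
  fixes a :: "'a::idom"
  assumes "P * x + a * y + c * t = 0" "a * x + Q * y + b * t = 0" "c * x + b * y + R * t = 0"
    and "x \<noteq> 0 \<or> y \<noteq> 0 \<or> t \<noteq> 0"
  shows "sym_det a b c P Q R = 0"
proof -
  have "sym_det a b c P Q R * x = 0" "sym_det a b c P Q R * y = 0" "sym_det a b c P Q R * t = 0"
    using assms(1-3) unfolding sym_det_def by algebra+
  then show ?thesis using assms(4) by auto
qed

text \<open>At a real fibre, sums and differences of the two halves of an eigenvector decouple.\<close>

lemma real_fibre_det:
  fixes w z :: real
  assumes sym: "\<gamma> 4 = \<gamma> 1" "\<gamma> 5 = \<gamma> 2" "\<gamma> 6 = \<gamma> 3"
    and x: "fibre_eigenvector \<gamma> w z (complex_of_real l) x"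
  shows "sym_det (\<gamma> 1) (\<gamma> 2) (\<gamma> 3) (z * \<gamma> 9 - l) (w * \<gamma> 8 - l) (\<gamma> 7 - l) *
         sym_det (\<gamma> 1) (\<gamma> 2) (\<gamma> 3) (- z * \<gamma> 9 - l) (- w * \<gamma> 8 - l) (- \<gamma> 7 - l) = 0"
proof -
  note eqs = x[unfolded fibre_eigenvector_def complex_cnj_complex_of_real sym]
  have both: "u = 0 \<and> v = 0" if "u + v = 0" "u - v = 0" for u v :: complex
    using that by (simp add: eq_neg_iff_add_eq_0[symmetric])
  have "\<exists>s. x s \<noteq> 0" using eqs by blast
  then obtain s where "x s \<noteq> 0" ..
  \<comment> \<open>If all sums and differences of paired entries vanished, then so would
    \<open>x\<close>.\<close>
  then consider "x V1 + x V5 \<noteq> 0 \<or> x V2 + x V6 \<noteq> 0 \<or> x V3 + x V4 \<noteq> 0"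
    | "x V1 - x V5 \<noteq> 0 \<or> x V2 - x V6 \<noteq> 0 \<or> x V3 - x V4 \<noteq> 0"
    by (cases s) (metis both)+
  then have "sym_det (complex_of_real (\<gamma> 1)) (\<gamma> 2) (\<gamma> 3) (z * \<gamma> 9 - l) (w * \<gamma> 8 - l) (\<gamma> 7 - l) = 0 \<or>
    sym_det (complex_of_real (\<gamma> 1)) (\<gamma> 2) (\<gamma> 3) (- z * \<gamma> 9 - l) (- w * \<gamma> 8 - l) (- \<gamma> 7 - l) = 0"
  proof cases
    case 1
    have "(z * \<gamma> 9 - l) * (x V1 + x V5) + \<gamma> 1 * (x V2 + x V6) + \<gamma> 3 * (x V3 + x V4) = 0"
      "\<gamma> 1 * (x V1 + x V5) + (w * \<gamma> 8 - l) * (x V2 + x V6) + \<gamma> 2 * (x V3 + x V4) = 0"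
      "\<gamma> 3 * (x V1 + x V5) + \<gamma> 2 * (x V2 + x V6) + (\<gamma> 7 - l) * (x V3 + x V4) = 0"
      using eqs by (simp_all add: algebra_simps)
    from sym_det_zero[OF this 1] show ?thesis by simp
  next
    case 2
    have "(- z * \<gamma> 9 - l) * (x V1 - x V5) + \<gamma> 1 * (x V2 - x V6) + \<gamma> 3 * (x V3 - x V4) = 0"
      "\<gamma> 1 * (x V1 - x V5) + (- w * \<gamma> 8 - l) * (x V2 - x V6) + \<gamma> 2 * (x V3 - x V4) = 0"
      "\<gamma> 3 * (x V1 - x V5) + \<gamma> 2 * (x V2 - x V6) + (- \<gamma> 7 - l) * (x V3 - x V4) = 0"
      using eqs by (simp_all add: algebra_simps)
    from sym_det_zero[OF this 2] show ?thesis by simp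
  qed
  then have "complex_of_real (sym_det (\<gamma> 1) (\<gamma> 2) (\<gamma> 3)
        (z * \<gamma> 9 - l) (w * \<gamma> 8 - l) (\<gamma> 7 - l)) = 0 \<or>
      complex_of_real (sym_det (\<gamma> 1) (\<gamma> 2) (\<gamma> 3)
        (- z * \<gamma> 9 - l) (- w * \<gamma> 8 - l) (- \<gamma> 7 - l)) = 0"
    by (simp add: of_real_sym_det)
  then show ?thesis by (simp only: of_real_eq_0_iff mult_eq_0_iff)
qed

lemma flat_band_quadratics:
  assumes sym: "\<gamma> 4 = \<gamma> 1" "\<gamma> 5 = \<gamma> 2" "\<gamma> 6 = \<gamma> 3"
    and pos: "\<gamma> 7 > 0" "\<gamma> 8 > 0" "\<gamma> 9 > 0"
    and "\<mu> \<noteq> 0" "1 - l / \<mu> \<in> flat_bands \<gamma> \<mu>"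
  shows "(\<gamma> 1 * \<gamma> 2 + l * \<gamma> 3)^2 = (\<gamma> 8 * \<gamma> 3)^2"
    and "(\<gamma> 1 * \<gamma> 3 + l * \<gamma> 2)^2 = (\<gamma> 9 * \<gamma> 2)^2"
    and "(\<gamma> 2 * \<gamma> 3 + l * \<gamma> 1)^2 = (\<gamma> 7 * \<gamma> 1)^2"
proof -
  define F where "F w z =
      sym_det (\<gamma> 1) (\<gamma> 2) (\<gamma> 3) (z * \<gamma> 9 - l) (w * \<gamma> 8 - l) (\<gamma> 7 - l) *
      sym_det (\<gamma> 1) (\<gamma> 2) (\<gamma> 3) (- z * \<gamma> 9 - l) (- w * \<gamma> 8 - l) (- \<gamma> 7 - l)" for w z
  have "F w z = 0" if wz: "w \<in> {1, -1}" "z \<in> {1, -1}" for w z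
  proof -
    \<comment> \<open>The angles are \<open>0\<close> or \<open>pi\<close>.\<close>
    obtain s t where "cis s = complex_of_real w" "cis t = complex_of_real z"
      using wz cis_pi cis_zero by (metis insertE of_real_1 of_real_minus singletonD)
    then obtain x where "fibre_eigenvector \<gamma> w z (complex_of_real l) x"
      using assms(7,8) by (metis flat_band_iff fst_conv snd_conv)
    from real_fibre_det[OF sym this] show ?thesis by (simp add: F_def)
  qed
  then have F: "F 1 1 = 0" "F 1 (-1) = 0" "F (-1) 1 = 0" "F (-1) (-1) = 0" by simp_all
  \<comment> \<open>The first group collects the terms of even degree in \<open>\<gamma> 7\<close>,
    \<open>\<gamma> 8\<close>, \<open>\<gamma> 9\<close>, the second those of odd degree. Replacing
    \<open>D\<close> by \<open>-D\<close> flips only the odd part, so \<open>F\<close> becomes a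
    difference of two squares.\<close>
  define k a1 a2 a3 where
    "k = sym_det (\<gamma> 1) (\<gamma> 2) (\<gamma> 3) (- l) (- l) (- l)" and
    "a1 = - \<gamma> 7 * \<gamma> 8 * l" and "a2 = - \<gamma> 7 * \<gamma> 9 * l" and "a3 = - \<gamma> 8 * \<gamma> 9 * l"
  define b1 b2 b3 m where
    "b1 = \<gamma> 9 * (l^2 - (\<gamma> 2)^2)" and "b2 = \<gamma> 8 * (l^2 - (\<gamma> 3)^2)" and
    "b3 = \<gamma> 7 * (l^2 - (\<gamma> 1)^2)" and "m = \<gamma> 7 * \<gamma> 8 * \<gamma> 9"
  note defs = k_def a1_def a2_def a3_def b1_def b2_def b3_def m_def sym_det_def
  have plus: "sym_det (\<gamma> 1) (\<gamma> 2) (\<gamma> 3) (z * \<gamma> 9 - l) (w * \<gamma> 8 - l) (\<gamma> 7 - l) =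
      (k + z * a2 + w * a1 + z * w * a3) + (z * b1 + w * b2 + b3 + z * w * m)" for w z
    by (simp add: defs algebra_simps power2_eq_square)
  have minus: "sym_det (\<gamma> 1) (\<gamma> 2) (\<gamma> 3) (- z * \<gamma> 9 - l) (- w * \<gamma> 8 - l) (- \<gamma> 7 - l) =
      (k + z * a2 + w * a1 + z * w * a3) - (z * b1 + w * b2 + b3 + z * w * m)" for w z
    by (simp add: defs algebra_simps power2_eq_square)
  have F_eq: "F w z = (k + z * a2 + w * a1 + z * w * a3)^2 - (z * b1 + w * b2 + b3 + z * w * m)^2"
    for w z
    unfolding F_def plus minus by (simp add: square_diff_square_factored power2_eq_square)
  \<comment> \<open>On signs, \<open>F\<close> is a combination of \<open>1\<close>,
    \<open>z\<close>, \<open>w\<close> and \<open>z * w\<close>. Summing with the sign of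
    \<open>z\<close> isolates four times the coefficient of \<open>z\<close>; the two sums below do
    the same for \<open>w\<close> and \<open>z * w\<close>.\<close>
  have "F 1 1 - F 1 (-1) + F (-1) 1 - F (-1) (-1) = 8 * (k * a2 + a1 * a3 - b1 * b3 - b2 * m)"
    by (simp add: F_eq algebra_simps power2_eq_square)
  moreover have "k * a2 + a1 * a3 - b1 * b3 - b2 * m =
      \<gamma> 7 * \<gamma> 9 * ((\<gamma> 8 * \<gamma> 3)^2 - (\<gamma> 1 * \<gamma> 2 + l * \<gamma> 3)^2)"
    by (simp add: defs algebra_simps power2_eq_square)
  ultimately show "(\<gamma> 1 * \<gamma> 2 + l * \<gamma> 3)^2 = (\<gamma> 8 * \<gamma> 3)^2" using F pos by simp
  have "F 1 1 + F 1 (-1) - F (-1) 1 - F (-1) (-1) = 8 * (k * a1 + a2 * a3 - b2 * b3 - b1 * m)"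
    by (simp add: F_eq algebra_simps power2_eq_square)
  moreover have "k * a1 + a2 * a3 - b2 * b3 - b1 * m =
      \<gamma> 7 * \<gamma> 8 * ((\<gamma> 9 * \<gamma> 2)^2 - (\<gamma> 1 * \<gamma> 3 + l * \<gamma> 2)^2)"
    by (simp add: defs algebra_simps power2_eq_square)
  ultimately show "(\<gamma> 1 * \<gamma> 3 + l * \<gamma> 2)^2 = (\<gamma> 9 * \<gamma> 2)^2" using F pos by simp
  have "F 1 1 - F 1 (-1) - F (-1) 1 + F (-1) (-1) = 8 * (k * a3 + a1 * a2 - b1 * b2 - b3 * m)"
    by (simp add: F_eq algebra_simps power2_eq_square)
  moreover have "k * a3 + a1 * a2 - b1 * b2 - b3 * m =
      \<gamma> 8 * \<gamma> 9 * ((\<gamma> 7 * \<gamma> 1)^2 - (\<gamma> 2 * \<gamma> 3 + l * \<gamma> 1)^2)"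
    by (simp add: defs algebra_simps power2_eq_square)
  ultimately show "(\<gamma> 2 * \<gamma> 3 + l * \<gamma> 1)^2 = (\<gamma> 7 * \<gamma> 1)^2" using F pos by simp
qed

section \<open>Comparison of two flat bands\<close>

text \<open>Vieta's formula for a quadratic in \<open>l\<close>. It does not involve
  \<open>q\<close>, which eliminates the dodecagon weights.\<close>

lemma sum_of_roots:
  fixes m c l l' q :: real
  assumes "(m + l * c)^2 = q" "(m + l' * c)^2 = q" "l \<noteq> l'" "c > 0"
  shows "(l + l') * c = - 2 * m"
proof -
  have "c * (l - l') * ((l + l') * c + 2 * m) = (m + l * c)^2 - (m + l' * c)^2"
    by (simp add: algebra_simps power2_eq_square)
  then have "c * (l - l') * ((l + l') * c + 2 * m) = 0" using assms(1,2) by simp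
  then show ?thesis using assms(3,4) by simp
qed

lemma two_flat_bands_weights:
  assumes sym: "\<gamma> 4 = \<gamma> 1" "\<gamma> 5 = \<gamma> 2" "\<gamma> 6 = \<gamma> 3"
    and pos: "\<gamma> 1 > 0" "\<gamma> 2 > 0" "\<gamma> 3 > 0" "\<gamma> 7 > 0" "\<gamma> 8 > 0" "\<gamma> 9 > 0"
    and mu: "\<mu> \<noteq> 0" and flat: "E \<in> flat_bands \<gamma> \<mu>" "E' \<in> flat_bands \<gamma> \<mu>" "E \<noteq> E'"
  shows "\<gamma> 1 = \<gamma> 2" "\<gamma> 2 = \<gamma> 3"
proof -
  define l l' where "l = \<mu> * (1 - E)" and "l' = \<mu> * (1 - E')"
  have "l \<noteq> l'" and "1 - l / \<mu> \<in> flat_bands \<gamma> \<mu>" "1 - l' / \<mu> \<in> flat_bands \<gamma> \<mu>"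
    using mu flat by (simp_all add: l_def l'_def)
  note q = flat_band_quadratics[OF sym pos(4-6) mu this(2)]
    flat_band_quadratics[OF sym pos(4-6) mu this(3)]
  have s: "(l + l') * \<gamma> 3 = - 2 * (\<gamma> 1 * \<gamma> 2)" "(l + l') * \<gamma> 2 = - 2 * (\<gamma> 1 * \<gamma> 3)"
    "(l + l') * \<gamma> 1 = - 2 * (\<gamma> 2 * \<gamma> 3)"
    using sum_of_roots[OF q(1,4) \<open>l \<noteq> l'\<close> pos(3)] sum_of_roots[OF q(2,5) \<open>l \<noteq> l'\<close> pos(2)]
      sum_of_roots[OF q(3,6) \<open>l \<noteq> l'\<close> pos(1)] by simp_all
  \<comment> \<open>Cross-multiplying two of the equations \<open>s\<close> cancels
    \<open>l + l'\<close>: the second and third give the first claim, the first and second give the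
    other. Positivity then selects the equal sign in the square roots.\<close>
  have "\<gamma> 3 * (\<gamma> 1 ^ 2 - \<gamma> 2 ^ 2) = 0" "\<gamma> 1 * (\<gamma> 2 ^ 2 - \<gamma> 3 ^ 2) = 0" using s by algebra+
  then show "\<gamma> 1 = \<gamma> 2" "\<gamma> 2 = \<gamma> 3" using pos by (simp_all add: power2_eq_iff)
qed

section \<open>Flat bands for equal weights\<close>

text \<open>
  The first half \<open>(u, v, t)\<close> is the cross product of \<open>(1, 1, 1)\<close> and \<open>(cnj z, cnj w, 1)\<close>, unless
  these are parallel.
\<close>

lemma dodecagon_eigenvector:
  fixes \<alpha> \<beta> \<epsilon> :: real
  assumes a: "\<forall>k\<in>{1..6}. \<gamma> k = \<alpha>" and b: "\<forall>k\<in>{7..9}. \<gamma> k = \<beta>"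
    and e: "\<epsilon> * \<epsilon> = 1" and wz: "w * cnj w = 1" "z * cnj z = 1"
  shows "\<exists>x. fibre_eigenvector \<gamma> w z (complex_of_real (- \<alpha> + \<epsilon> * \<beta>)) x"
proof -
  obtain u v t where nz: "u \<noteq> 0 \<or> v \<noteq> 0 \<or> t \<noteq> 0" and s: "u + v + t = 0"
    and s': "cnj z * u + cnj w * v + t = 0"
  proof (cases "w = 1 \<and> z = 1")
    case True
    then show ?thesis using that[of 1 "-1" 0] by simp
  next
    case False
    then show ?thesis using that[of "1 - cnj w" "cnj z - 1" "cnj w - cnj z"]
      by (auto simp: algebra_simps)
  qed
  \<comment> \<open>On vectors with sum zero, \<open>A\<close> acts as \<open>- \<alpha>\<close>. By
    \<open>s\<close> and \<open>s'\<close> both halves have sum zero, and the coupling sends each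
    half to \<open>\<epsilon> * \<beta>\<close> times the other's partner entries, which produces
    the eigenvalue \<open>- \<alpha> + \<epsilon> * \<beta>\<close>.\<close>
  define x where "x s = (case s of V1 \<Rightarrow> u | V2 \<Rightarrow> v | V3 \<Rightarrow> t
    | V4 \<Rightarrow> \<epsilon> * t | V5 \<Rightarrow> \<epsilon> * (cnj z * u) | V6 \<Rightarrow> \<epsilon> * (cnj w * v))" for s
  have e': "complex_of_real \<epsilon> * \<epsilon> = 1" using e by (metis of_real_1 of_real_mult)
  have g: "\<gamma> 1 = \<alpha>" "\<gamma> 2 = \<alpha>" "\<gamma> 3 = \<alpha>" "\<gamma> 4 = \<alpha>" "\<gamma> 5 = \<alpha>" "\<gamma> 6 = \<alpha>"
    "\<gamma> 7 = \<beta>" "\<gamma> 8 = \<beta>" "\<gamma> 9 = \<beta>" using a b by simp_all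
  have "\<exists>s. x s \<noteq> 0"
    using nz by (metis (no_types, lifting) x_def site.case(1,2,3))
  then have "fibre_eigenvector \<gamma> w z (complex_of_real (- \<alpha> + \<epsilon> * \<beta>)) x"
    unfolding fibre_eigenvector_def g of_real_add of_real_minus of_real_mult
    using s s' e' wz by (intro conjI; (assumption | simp only: x_def site.case; algebra))
  then show ?thesis by blast
qed

lemma equal_weights_flat_bands:
  assumes a: "\<forall>k\<in>{1..6}. \<gamma> k = \<alpha>" and b: "\<forall>k\<in>{7..9}. \<gamma> k = \<beta>"
    and "\<alpha> > 0" "\<beta> > 0" and mu: "\<mu> \<noteq> 0"
  shows "flat_bands \<gamma> \<mu> = {1 - (- \<alpha> + \<beta>) / \<mu>, 1 - (- \<alpha> - \<beta>) / \<mu>}"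
proof (intro equalityI subsetI)
  fix E assume E: "E \<in> flat_bands \<gamma> \<mu>"
  define l where "l = \<mu> * (1 - E)"
  have El: "E = 1 - l / \<mu>" using mu by (simp add: l_def)
  have g: "\<gamma> 1 = \<alpha>" "\<gamma> 2 = \<alpha>" "\<gamma> 3 = \<alpha>" "\<gamma> 4 = \<alpha>" "\<gamma> 5 = \<alpha>" "\<gamma> 6 = \<alpha>"
    "\<gamma> 7 = \<beta>" "\<gamma> 8 = \<beta>" "\<gamma> 9 = \<beta>" using a b by simp_all
  \<comment> \<open>One of the three quadratics already leaves just two candidates.\<close>
  have "(\<alpha> * \<alpha> + l * \<alpha>)^2 = (\<beta> * \<alpha>)^2"
    using flat_band_quadratics(1)[of \<gamma>, OF _ _ _ _ _ _ mu E[unfolded El]] assms(4) by (simp only: g)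
  then have "\<alpha>^2 * ((l + \<alpha> - \<beta>) * (l + \<alpha> + \<beta>)) = 0" by algebra
  then have "l = - \<alpha> + \<beta> \<or> l = - \<alpha> - \<beta>" using assms(3) by auto
  then show "E \<in> {1 - (- \<alpha> + \<beta>) / \<mu>, 1 - (- \<alpha> - \<beta>) / \<mu>}" by (auto simp: El)
next
  have "1 - (- \<alpha> + \<epsilon> * \<beta>) / \<mu> \<in> flat_bands \<gamma> \<mu>" if "\<epsilon> * \<epsilon> = 1" for \<epsilon>
    unfolding flat_band_iff[OF mu]
    using dodecagon_eigenvector[OF a b that] by (simp add: cis_cnj cis_mult)
  from this[of 1] this[of "-1"]
  show "E \<in> flat_bands \<gamma> \<mu>" if "E \<in> {1 - (- \<alpha> + \<beta>) / \<mu>, 1 - (- \<alpha> - \<beta>) / \<mu>}" for E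
    using that by auto
qed

theorem theorem10:
  fixes \<gamma> :: "nat \<Rightarrow> real" and \<mu> :: real
  assumes "\<mu> > 0"
    and "\<forall>k\<in>{1..9}. \<gamma> k > 0"
    and "\<gamma> 2 + \<gamma> 3 + \<gamma> 7 = \<mu>"
    and "\<gamma> 5 + \<gamma> 6 + \<gamma> 7 = \<mu>"
    and "\<gamma> 1 + \<gamma> 2 + \<gamma> 8 = \<mu>"
    and "\<gamma> 4 + \<gamma> 5 + \<gamma> 8 = \<mu>"
    and "\<gamma> 1 + \<gamma> 3 + \<gamma> 9 = \<mu>"
    and "\<gamma> 4 + \<gamma> 6 + \<gamma> 9 = \<mu>"
  shows "card (flat_bands \<gamma> \<mu>) = 2 \<longleftrightarrow>
    monomeric \<gamma> \<and>
    (\<exists>\<alpha> \<beta>. \<alpha> > 0 \<and> \<beta> > 0 \<and> 2 * \<alpha> + \<beta> = \<mu> \<and>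
       (\<forall>k\<in>{1..6}. \<gamma> k = \<alpha>) \<and> (\<forall>k\<in>{7..9}. \<gamma> k = \<beta>))"
    (is "_ \<longleftrightarrow> _ \<and> ?equal")
proof
  assume "card (flat_bands \<gamma> \<mu>) = 2"
  then obtain E E' where E: "E \<in> flat_bands \<gamma> \<mu>" "E' \<in> flat_bands \<gamma> \<mu>" "E \<noteq> E'"
    by (auto simp: card_2_iff)
  \<comment> \<open>At paired vertices the dodecagon weight cancels, so any two of the differences
    \<open>\<gamma> 4 - \<gamma> 1\<close>, \<open>\<gamma> 5 - \<gamma> 2\<close>,
    \<open>\<gamma> 6 - \<gamma> 3\<close> sum to zero; hence all three vanish.\<close>
  have sym: "\<gamma> 4 = \<gamma> 1" "\<gamma> 5 = \<gamma> 2" "\<gamma> 6 = \<gamma> 3" using assms(3-8) by linarith+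
  have pos: "\<gamma> 1 > 0" "\<gamma> 2 > 0" "\<gamma> 3 > 0" "\<gamma> 7 > 0" "\<gamma> 8 > 0" "\<gamma> 9 > 0"
    using assms(2) by simp_all
  have "\<mu> \<noteq> 0" using assms(1) by simp
  note tri = two_flat_bands_weights[OF sym pos this E]
  then have dod: "\<gamma> 8 = \<gamma> 7" "\<gamma> 9 = \<gamma> 7" using assms(3-8) by linarith+
  have "{1..6} = {1, 2, 3, 4, 5, 6 :: nat}" "{7..9} = {7, 8, 9 :: nat}" by auto
  then have "(\<forall>k\<in>{1..6}. \<gamma> k = \<gamma> 1) \<and> (\<forall>k\<in>{7..9}. \<gamma> k = \<gamma> 7)"
    using sym tri dod by simp
  moreover have "2 * \<gamma> 1 + \<gamma> 7 = \<mu>" using tri assms(3) by linarith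
  ultimately have ?equal using pos(1,4) by blast
  moreover have "monomeric \<gamma>"
  proof -
    have "weight_cycle \<gamma> v = [\<gamma> 7, \<gamma> 1, \<gamma> 1]" for v
      using sym tri dod by (cases v; cases "fst v") (auto simp: weight_cycle_simps)
    then show ?thesis unfolding monomeric_def by (metis rotate0 id_apply)
  qed
  ultimately show "monomeric \<gamma> \<and> ?equal" by blast
next
  assume "monomeric \<gamma> \<and> ?equal"
  then obtain \<alpha> \<beta> where ab: "\<forall>k\<in>{1..6}. \<gamma> k = \<alpha>" "\<forall>k\<in>{7..9}. \<gamma> k = \<beta>" "\<alpha> > 0" "\<beta> > 0"
    by blast
  have "\<mu> \<noteq> 0" using assms(1) by simp
  \<comment> \<open>The two energies differ by \<open>2 * \<beta> / \<mu>\<close>, which is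
    nonzero.\<close>
  from equal_weights_flat_bands[OF ab this] show "card (flat_bands \<gamma> \<mu>) = 2"
    using ab(4) assms(1) by (simp add: field_simps)
qed

end
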